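(* Let $k\geq 3$ be an integer and let $G$ be a finite simple graph. If $$\sum_{0\leq j\leq k-1} c_{2j+1}(G-X)\leq \frac{5}{6k^{2}}|X| \quad\text{for all } X\subseteq V(G),$$ then $G$ has a $\{P_{2},P_{2k+1}\}$-factor.
   Context: For a graph $H$ and an integer $j\geq 1$, $c_{j}(H)$ denotes the number of connected components of $H$ having exactly $j$ vertices. $P_n$ denotes the path on $n$ vertices. For a set $\mathcal{F}$ of connected graphs, an $\mathcal{F}$-factor of $G$ is a spanning subgraph of $G$ each of whose components is isomorphic to a member of $\mathcal{F}$. *)

theory Defs
  imports Complex_Main
begin

definition simple_graph :: "'a set \<Rightarrow> 'a set set \<Rightarrow> bool" where
  "simple_graph V E \<longleftrightarrow> finite V \<and>
     (\<forall>e\<in>E. \<exists>u v. e = {u, v} \<and> u \<noteq> v \<and> u \<in> V \<and> v \<in> V)"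

definition adj_in :: "'a set set \<Rightarrow> 'a set \<Rightarrow> 'a \<Rightarrow> 'a \<Rightarrow> bool" where
  "adj_in E S u v \<longleftrightarrow> u \<in> S \<and> v \<in> S \<and> {u, v} \<in> E"

definition component_of :: "'a set set \<Rightarrow> 'a set \<Rightarrow> 'a \<Rightarrow> 'a set" where
  "component_of E S v = {u \<in> S. (adj_in E S)\<^sup>*\<^sup>* v u}"

definition components :: "'a set set \<Rightarrow> 'a set \<Rightarrow> 'a set set" where
  "components E S = component_of E S ` S"

definition comp_count :: "nat \<Rightarrow> 'a set set \<Rightarrow> 'a set \<Rightarrow> nat" where
  "comp_count j E S = card {C \<in> components E S. card C = j}"

definition is_path_on :: "nat \<Rightarrow> 'a set set \<Rightarrow> 'a set \<Rightarrow> bool" where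
  "is_path_on n F C \<longleftrightarrow> (\<exists>f. bij_betw f {0..<n} C \<and>
      (\<forall>i<n. \<forall>j<n. {f i, f j} \<in> F \<longleftrightarrow> (i + 1 = j \<or> j + 1 = i)))"

definition path_factor :: "nat set \<Rightarrow> 'a set \<Rightarrow> 'a set set \<Rightarrow> 'a set set \<Rightarrow> bool" where
  "path_factor Ns V E F \<longleftrightarrow> F \<subseteq> E \<and>
     (\<forall>C\<in>components F V. \<exists>n\<in>Ns. is_path_on n F C)"

end

theory Submission
  imports Defs
begin

text \<open>
  Deleting the neighbourhood of an independent set \<open>I\<close> isolates every vertex of \<open>I\<close>, so the
  hypothesis forces \<open>\<bar>N(I)\<bar> \<ge> 6k\<^sup>2\<bar>I\<bar>/5 \<ge> (2k - 1)\<bar>I\<bar>\<close>.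

  By Gallai and Edmonds there is a set \<open>S\<close> such that \<open>V - S\<close> splits into factor-critical parts
  without edges between them, and \<open>S\<close> can be matched into distinct parts. A factor-critical part \<open>C\<close>
  in which all degrees are at least \<open>2k - 1\<close> has the required factor: starting with an unmatched vertex, an
  alternating path is extended greedily to \<open>2k + 1\<close> vertices, and the rest stays perfectly matched.
  Every other part contains a vertex with at most \<open>2k - 2\<close> neighbours inside the part. One such vertex
  from each of \<open>t\<close> parts forms an independent set, so these parts have at least \<open>t\<close> neighbours
  in \<open>S\<close>. By Hall's theorem all the bad parts can be matched into \<open>S\<close>, and combining the two
  matchings leaves only good parts unmatched.
\<close>

section \<open>Matchings in bipartite graphs\<close>

text \<open>Induction on \<open>card A\<close>, after Halmos and Vaughan: a tight proper subset
  splits the problem into two smaller ones; without one, an arbitrary choice for one element leaves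
  Hall's condition intact.\<close>

lemma hall:
  assumes "finite A" "\<And>a. a \<in> A \<Longrightarrow> finite (N a)"
    and "\<And>B. B \<subseteq> A \<Longrightarrow> card B \<le> card (\<Union>(N ` B))"
  shows "\<exists>g. inj_on g A \<and> (\<forall>a\<in>A. g a \<in> N a)"
  using assms
proof (induction "card A" arbitrary: A N rule: less_induct)
  case less
  note fin = less.prems(1) and finN = less.prems(2) and H = less.prems(3)
  show ?case
  proof (cases "\<exists>B. B \<noteq> {} \<and> B \<subset> A \<and> card (\<Union>(N ` B)) = card B")
    case True
    then obtain B where B: "B \<noteq> {}" "B \<subset> A" "card (\<Union>(N ` B)) = card B" by blast
    have finB: "finite B" using B fin finite_subset by blast
    have finNB: "finite (\<Union>(N ` B))" using finB finN B by auto
    have "\<exists>g. inj_on g B \<and> (\<forall>a\<in>B. g a \<in> N a)"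
      using B(2) finB finN H by (intro less.hyps) (auto simp: psubset_card_mono[OF fin])
    then obtain g where g: "inj_on g B" "\<forall>a\<in>B. g a \<in> N a" by blast
    let ?N = "\<lambda>a. N a - \<Union>(N ` B)"
    have "\<exists>h. inj_on h (A - B) \<and> (\<forall>a\<in>A - B. h a \<in> ?N a)"
    proof (rule less.hyps)
      show "card (A - B) < card A"
        using B fin by (intro psubset_card_mono) auto
      show "card D \<le> card (\<Union>(?N ` D))" if "D \<subseteq> A - B" for D
      proof -
        have finD: "finite D" using that fin by (meson finite_Diff finite_subset)
        \<comment> \<open>Hall's condition for \<open>D \<union> B\<close>, less the tight count for
          \<open>B\<close>, is the condition for \<open>D\<close> once the neighbours of
          \<open>B\<close> are deleted.\<close>
        have "card D + card B = card (D \<union> B)"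
          using that finD finB by (subst card_Un_disjoint) auto
        also have "\<dots> \<le> card (\<Union>(N ` (D \<union> B)))"
          using that B by (intro H) auto
        also have "\<Union>(N ` (D \<union> B)) = \<Union>(?N ` D) \<union> \<Union>(N ` B)" by auto
        also have "card \<dots> \<le> card (\<Union>(?N ` D)) + card (\<Union>(N ` B))" by (rule card_Un_le)
        finally show ?thesis using B by simp
      qed
    qed (use fin finN in auto)
    then obtain h where h: "inj_on h (A - B)" "\<forall>a\<in>A - B. h a \<in> ?N a" by blast
    let ?f = "\<lambda>a. if a \<in> B then g a else h a"
    have "inj_on ?f A"
      using g h B(2) unfolding inj_on_def by (smt (verit) DiffE DiffI UN_I)
    moreover have "\<forall>a\<in>A. ?f a \<in> N a" using g h by auto
    ultimately show ?thesis by blast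
  next
    case strict: False
    show ?thesis
    proof (cases "A = {}")
      case False
      then obtain a where a: "a \<in> A" by blast
      have "card {a} \<le> card (\<Union>(N ` {a}))" using a by (intro H) auto
      then have "N a \<noteq> {}" by auto
      then obtain b where b: "b \<in> N a" by blast
      let ?N = "\<lambda>x. N x - {b}"
      have "\<exists>h. inj_on h (A - {a}) \<and> (\<forall>x\<in>A - {a}. h x \<in> ?N x)"
      proof (rule less.hyps)
        show "card (A - {a}) < card A" using fin a by (rule card_Diff1_less)
        show "card D \<le> card (\<Union>(?N ` D))" if D: "D \<subseteq> A - {a}" for D
        proof (cases "D = {}")
          case False
          have "card D \<le> card (\<Union>(N ` D))" using D by (intro H) auto
          \<comment> \<open>\<open>D\<close> misses \<open>a\<close>, so it is proper and not tight;
            the strict inequality pays for the loss of \<open>b\<close>.\<close>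
          moreover have "card (\<Union>(N ` D)) \<noteq> card D" using strict False D a by blast
          ultimately have "card D < card (\<Union>(N ` D))" by simp
          moreover have "\<Union>(?N ` D) = \<Union>(N ` D) - {b}" by auto
          ultimately show ?thesis by (auto simp: card_Diff_singleton_if)
        qed simp
      qed (use fin finN in auto)
      then obtain h where h: "inj_on h (A - {a})" "\<forall>x\<in>A - {a}. h x \<in> ?N x" by blast
      have "inj_on (h(a := b)) A"
        using h unfolding inj_on_def by auto
      moreover have "\<forall>x\<in>A. (h(a := b)) x \<in> N x" using h b by auto
      ultimately show ?thesis by blast
    qed simp
  qed
qed

text \<open>Alternating paths: from an element of \<open>T\<close> missed by \<open>g\<close>, each
  round follows \<open>h\<close> to \<open>h c\<close> and then \<open>g\<close> to
  \<open>g (h c)\<close>, and stops on leaving \<open>T\<close>.\<close>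

inductive_set chain :: "('s \<Rightarrow> 'c) \<Rightarrow> ('c \<Rightarrow> 's) \<Rightarrow> 's set \<Rightarrow> 'c set \<Rightarrow> 'c set"
  for g h S T where
  start: "c \<in> T \<Longrightarrow> c \<notin> g ` S \<Longrightarrow> c \<in> chain g h S T"
| step: "c \<in> chain g h S T \<Longrightarrow> g (h c) \<in> T \<Longrightarrow> g (h c) \<in> chain g h S T"

lemma chain_subset: "chain g h S T \<subseteq> T"
  by (auto elim: chain.cases)

text \<open>Mendelsohn and Dulmage, with the proof of the Schroeder-Bernstein theorem: along the
  chains that start outside \<open>g ` S\<close> the matching \<open>g\<close> is replaced by \<open>h\<close>.\<close>

lemma mendelsohn_dulmage:
  assumes g: "inj_on g S" "\<And>s. s \<in> S \<Longrightarrow> R s (g s)"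
    and h: "inj_on h T" "\<And>c. c \<in> T \<Longrightarrow> h c \<in> S \<and> R (h c) c"
  shows "\<exists>f. inj_on f S \<and> (\<forall>s\<in>S. R s (f s) \<and> f s \<in> g ` S \<union> T) \<and> T \<subseteq> f ` S"
proof -
  define A where "A = chain g h S T"
  have AT: "A \<subseteq> T" unfolding A_def by (rule chain_subset)
  define f where "f s = (if s \<in> h ` A then the_inv_into A h s else g s)" for s
  have injA: "inj_on h A" using h(1) AT inj_on_subset by blast
  have fh: "f (h c) = c" if "c \<in> A" for c
    using that injA by (simp add: f_def the_inv_into_f_f)
  have fg: "f s = g s" if "s \<notin> h ` A" for s using that by (simp add: f_def)
  \<comment> \<open>A member of \<open>A\<close> of the form \<open>g s\<close> starts no chain, so
    it is \<open>g (h c)\<close> with \<open>c\<close> in \<open>A\<close>, and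
    \<open>s = h c\<close>. Hence the values kept from \<open>g\<close> avoid \<open>A\<close>,
    where the switched values lie.\<close>
  have gA: "s \<in> h ` A" if "s \<in> S" "g s \<in> A" for s
  proof -
    from that(2) have "\<exists>c\<in>A. g s = g (h c)"
      unfolding A_def by (cases rule: chain.cases) (use that in auto)
    then show ?thesis using that(1) g(1) h(2) AT by (metis imageI inj_onD subsetD)
  qed
  have "inj_on f S"
  proof (rule inj_onI)
    fix s t assume st: "s \<in> S" "t \<in> S" "f s = f t"
    show "s = t"
    proof (cases "s \<in> h ` A"; cases "t \<in> h ` A")
      assume "s \<in> h ` A" "t \<in> h ` A"
      then show ?thesis using st(3) fh by auto
    next
      assume "s \<in> h ` A" "t \<notin> h ` A"
      then show ?thesis using st fh fg gA by fastforce
    next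
      assume "s \<notin> h ` A" "t \<in> h ` A"
      then show ?thesis using st fh fg gA by fastforce
    next
      assume "s \<notin> h ` A" "t \<notin> h ` A"
      then show ?thesis using st fg g(1) by (auto dest: inj_onD)
    qed
  qed
  moreover have "R s (f s) \<and> f s \<in> g ` S \<union> T" if "s \<in> S" for s
  proof (cases "s \<in> h ` A")
    case True
    then show ?thesis using fh h(2) AT by auto
  next
    case False
    then show ?thesis using fg g(2) that by auto
  qed
  \<comment> \<open>Outside \<open>A\<close>, \<open>c\<close> starts no chain, so
    \<open>c = g s\<close>. Were \<open>s = h d\<close> with \<open>d\<close> in \<open>A\<close>,
    the chain would go on to \<open>c\<close>; so \<open>f\<close> still agrees with
    \<open>g\<close> at \<open>s\<close>.\<close>
  moreover have "c \<in> f ` S" if c: "c \<in> T" for c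
  proof (cases "c \<in> A")
    case True
    then show ?thesis using fh h(2) AT by (metis imageI subsetD)
  next
    case False
    then have "c \<in> g ` S" using c chain.start unfolding A_def by metis
    then obtain s where s: "s \<in> S" "c = g s" by blast
    have "s \<notin> h ` A"
      using False c s chain.step unfolding A_def by (metis imageE)
    then show ?thesis using s fg by force
  qed
  ultimately show ?thesis by blast
qed

section \<open>Tilings by paths\<close>

text \<open>The path need not be induced: further edges of \<open>E\<close> inside \<open>B\<close>
  are allowed.\<close>

definition path_spanned :: "'a set set \<Rightarrow> nat set \<Rightarrow> 'a set \<Rightarrow> bool" where
  "path_spanned E N B \<longleftrightarrow> (\<exists>xs. distinct xs \<and> set xs = B \<and>
     successively (\<lambda>u v. {u, v} \<in> E) xs \<and> length xs \<in> N)"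

text \<open>For \<open>N = {2}\<close> this is a perfect matching of the graph induced on
  \<open>W\<close>.\<close>

definition tileable :: "'a set set \<Rightarrow> nat set \<Rightarrow> 'a set \<Rightarrow> bool" where
  "tileable E N W \<longleftrightarrow>
     (\<exists>P. pairwise disjnt P \<and> \<Union>P = W \<and> (\<forall>B\<in>P. path_spanned E N B))"

lemma tileable_mono: "tileable E N W \<Longrightarrow> N \<subseteq> N' \<Longrightarrow> tileable E N' W"
  unfolding tileable_def path_spanned_def
  by (elim exE conjE, rule exI, intro conjI, assumption, assumption) blast

lemma tileable_UN:
  assumes "\<And>i. i \<in> I \<Longrightarrow> tileable E N (A i)"
    and "\<And>i j. i \<in> I \<Longrightarrow> j \<in> I \<Longrightarrow> i \<noteq> j \<Longrightarrow> A i \<inter> A j = {}"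
  shows "tileable E N (\<Union>i\<in>I. A i)"
proof -
  have "\<forall>i\<in>I. \<exists>P. pairwise disjnt P \<and> \<Union>P = A i \<and> (\<forall>B\<in>P. path_spanned E N B)"
    using assms(1) unfolding tileable_def by blast
  then obtain P where P: "\<And>i. i \<in> I \<Longrightarrow> pairwise disjnt (P i)" "\<And>i. i \<in> I \<Longrightarrow> \<Union>(P i) = A i"
    "\<And>i B. i \<in> I \<Longrightarrow> B \<in> P i \<Longrightarrow> path_spanned E N B"
    by metis
  have "disjnt B D" if BD: "i \<in> I" "B \<in> P i" "j \<in> I" "D \<in> P j" "B \<noteq> D" for i j B D
  proof (cases "i = j")
    case True
    then show ?thesis using P(1) BD by (auto simp: pairwise_def)
  next
    case False
    have "B \<subseteq> A i" "D \<subseteq> A j" using P(2) BD by blast+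
    then show ?thesis using assms(2)[OF BD(1,3) False] by (auto simp: disjnt_def)
  qed
  then have "pairwise disjnt (\<Union>i\<in>I. P i)" unfolding pairwise_def by blast
  moreover have "\<Union>(\<Union>i\<in>I. P i) = (\<Union>i\<in>I. A i)" using P(2) by blast
  ultimately show ?thesis unfolding tileable_def using P(3) by (metis UN_E)
qed

lemma tileable_Un:
  assumes "tileable E N A" "tileable E N B" "A \<inter> B = {}"
  shows "tileable E N (A \<union> B)"
proof -
  have "tileable E N (\<Union>i\<in>(UNIV::bool set). if i then A else B)"
    using assms by (intro tileable_UN) (auto split: if_splits)
  moreover have "(\<Union>i\<in>(UNIV::bool set). if i then A else B) = A \<union> B"
    by (auto simp: UNIV_bool)
  ultimately show ?thesis by simp
qed

lemma tileable_path:
  assumes "distinct xs" "successively (\<lambda>u v. {u, v} \<in> E) xs" "length xs \<in> N"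
  shows "tileable E N (set xs)"
  unfolding tileable_def path_spanned_def
  by (rule exI[of _ "{set xs}"]) (use assms in auto)

text \<open>Lets an alternating path use up one matching edge while the remainder stays perfectly
  matched.\<close>

lemma tileable_2_partner:
  assumes "tileable E {2} W" "w \<in> W"
  shows "\<exists>x\<in>W. x \<noteq> w \<and> {w, x} \<in> E \<and> tileable E {2} (W - {w, x})"
proof -
  obtain P where P: "pairwise disjnt P" "\<Union>P = W" "\<forall>B\<in>P. path_spanned E {2} B"
    using assms(1) unfolding tileable_def by blast
  obtain B where B: "B \<in> P" "w \<in> B" using P assms(2) by blast
  obtain xs where xs: "distinct xs" "set xs = B" "successively (\<lambda>u v. {u, v} \<in> E) xs"
    "length xs = 2"
    using P(3) B unfolding path_spanned_def by blast
  obtain a b where ab: "xs = [a, b]"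
    using xs(4) by (auto simp: length_Suc_conv numeral_2_eq_2)
  then obtain x where x: "B = {w, x}" "x \<noteq> w" "{w, x} \<in> E"
    using xs B(2) by (auto simp: insert_commute)
  have "\<Union>(P - {B}) = W - B"
    using P(1,2) B(1) by (auto simp: pairwise_def disjnt_def)
  then have "tileable E {2} (W - B)"
    unfolding tileable_def using P(1,3)
    by (intro exI[of _ "P - {B}"]) (auto simp: pairwise_def)
  then show ?thesis using x P(2) B(1) by blast
qed

section \<open>From a tiling to a path factor\<close>

lemma tileable_path_factor:
  assumes "tileable E N V"
  shows "\<exists>F. path_factor N V E F"
proof -
  obtain P where P: "pairwise disjnt P" "\<Union>P = V" "\<forall>B\<in>P. path_spanned E N B"
    using assms unfolding tileable_def by blast
  from P(3) obtain p where p: "\<And>B. B \<in> P \<Longrightarrow> distinct (p B)" "\<And>B. B \<in> P \<Longrightarrow> set (p B) = B"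
    "\<And>B. B \<in> P \<Longrightarrow> successively (\<lambda>u v. {u, v} \<in> E) (p B)"
    "\<And>B. B \<in> P \<Longrightarrow> length (p B) \<in> N"
    unfolding path_spanned_def by metis
  \<comment> \<open>Only consecutive pairs are kept, so that each block becomes an induced path of
    \<open>F\<close>, as \<open>is_path_on\<close> demands.\<close>
  define F where "F = {{p B ! i, p B ! Suc i} | B i. B \<in> P \<and> Suc i < length (p B)}"
  have FE: "F \<subseteq> E"
    unfolding F_def using p(3) by (auto simp: successively_conv_nth)
  have same: "B = D" if "B \<in> P" "D \<in> P" "x \<in> B" "x \<in> D" for B D x
    using P(1) that by (auto simp: pairwise_def disjnt_def)
  have edge: "{p B ! i, p B ! j} \<in> F \<longleftrightarrow> i + 1 = j \<or> j + 1 = i"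
    if B: "B \<in> P" and ij: "i < length (p B)" "j < length (p B)" for B i j
  proof
    assume "{p B ! i, p B ! j} \<in> F"
    then obtain D l where D: "D \<in> P" "Suc l < length (p D)"
      "{p B ! i, p B ! j} = {p D ! l, p D ! Suc l}"
      unfolding F_def by blast
    have "p D ! l \<in> D" using p(2)[OF D(1)] D(2) by (metis Suc_lessD nth_mem)
    moreover have "p D ! l \<in> B" using D(3) p(2)[OF B] ij by (metis doubleton_eq_iff nth_mem)
    ultimately have "D = B" using same D(1) B by blast
    then show "i + 1 = j \<or> j + 1 = i"
      using D(2,3) p(1)[OF B] ij by (auto simp: doubleton_eq_iff nth_eq_iff_index_eq)
  next
    assume "i + 1 = j \<or> j + 1 = i"
    then show "{p B ! i, p B ! j} \<in> F"
      unfolding F_def using B ij by (auto simp: insert_commute)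
  qed
  \<comment> \<open>Every edge of \<open>F\<close> lies inside one block and blocks are disjoint, so
    a walk in \<open>F\<close> cannot leave its block.\<close>
  have stay: "u \<in> B" if "(adj_in F V)\<^sup>*\<^sup>* v u" "v \<in> B" "B \<in> P" for u v B
    using that
  proof (induction rule: rtranclp_induct)
    case (step y z)
    then have "y \<in> B" "{y, z} \<in> F" by (auto simp: adj_in_def)
    then obtain D l where D: "D \<in> P" "Suc l < length (p D)" "{y, z} = {p D ! l, p D ! Suc l}"
      unfolding F_def by blast
    then have "{y, z} \<subseteq> D" using p(2)[OF D(1)] by (metis Suc_lessD empty_subsetI insert_subset nth_mem)
    then show ?case using same[OF \<open>B \<in> P\<close> D(1) \<open>y \<in> B\<close>] by auto
  qed
  have inV: "x \<in> V" if "x \<in> B" "B \<in> P" for x B using that P(2) by blast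
  have adj: "adj_in F V (p B ! i) (p B ! j)"
    if "B \<in> P" "i < length (p B)" "j < length (p B)" "i + 1 = j \<or> j + 1 = i" for B i j
    using that edge inV p(2) unfolding adj_in_def by (metis nth_mem)
  have from0: "(adj_in F V)\<^sup>*\<^sup>* (p B ! 0) (p B ! i)" if "B \<in> P" "i < length (p B)" for B i
    using that
  proof (induction i)
    case (Suc i)
    then show ?case
      using adj[of B i "Suc i"] by (metis Suc_eq_plus1 Suc_lessD rtranclp.rtrancl_into_rtrancl)
  qed simp
  have to0: "(adj_in F V)\<^sup>*\<^sup>* (p B ! i) (p B ! 0)" if "B \<in> P" "i < length (p B)" for B i
    using that
  proof (induction i)
    case (Suc i)
    then show ?case
      using adj[of B "Suc i" i] by (metis Suc_eq_plus1 Suc_lessD converse_rtranclp_into_rtranclp)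
  qed simp
  have comp: "component_of F V v = B" if v: "v \<in> B" "B \<in> P" for v B
  proof
    show "component_of F V v \<subseteq> B" using stay v by (auto simp: component_of_def)
    show "B \<subseteq> component_of F V v"
    proof
      fix u assume u: "u \<in> B"
      obtain i j where "i < length (p B)" "p B ! i = v" "j < length (p B)" "p B ! j = u"
        using u v p(2) by (metis in_set_conv_nth)
      then show "u \<in> component_of F V v"
        using from0 to0 v u inV unfolding component_of_def
        by (metis (mono_tags, lifting) mem_Collect_eq rtranclp_trans)
    qed
  qed
  have "\<exists>n\<in>N. is_path_on n F C" if "C \<in> components F V" for C
  proof -
    from that obtain v where "v \<in> V" "C = component_of F V v" by (auto simp: components_def)
    then have C: "C \<in> P" using comp P(2) by auto
    have "bij_betw (\<lambda>i. p C ! i) {0..<length (p C)} C"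
      using bij_betw_nth[OF p(1)[OF C], of "{..<length (p C)}" C] p(2)[OF C]
      by (simp add: lessThan_atLeast0)
    then have "is_path_on (length (p C)) F C"
      unfolding is_path_on_def using edge[OF C] by blast
    then show ?thesis using p(4)[OF C] by blast
  qed
  then have "path_factor N V E F" unfolding path_factor_def using FE by blast
  then show ?thesis by blast
qed

section \<open>The Gallai-Edmonds decomposition\<close>

text \<open>The parts have odd order but need not be connected, so even components of the complement
  of \<open>S\<close> can be absorbed by any part.\<close>

definition barrier :: "'a set set \<Rightarrow> 'a set \<Rightarrow> 'a set \<Rightarrow> 'a set set \<Rightarrow> bool" where
  "barrier E V S P \<longleftrightarrow> S \<subseteq> V \<and> \<Union>P = V - S \<and>
     (\<forall>C\<in>P. odd (card C)) \<and>
     (\<forall>C\<in>P. \<forall>D\<in>P. C \<noteq> D \<longrightarrow> C \<inter> D = {} \<and> (\<forall>u\<in>C. \<forall>v\<in>D. {u, v} \<notin> E))"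

text \<open>This is factor-criticality. As \<open>c\<close> is arbitrary, a matching edge from
  outside may enter the part at any vertex.\<close>

definition critical :: "'a set set \<Rightarrow> 'a set \<Rightarrow> bool" where
  "critical E C \<longleftrightarrow> (\<forall>c\<in>C. tileable E {2} (C - {c}))"

definition touches :: "'a set set \<Rightarrow> 'a \<Rightarrow> 'a set \<Rightarrow> bool" where
  "touches E s C \<longleftrightarrow> (\<exists>c\<in>C. {s, c} \<in> E)"

lemma barrierD:
  assumes "barrier E V S P"
  shows "S \<subseteq> V" "\<Union>P = V - S"
    and "C \<in> P \<Longrightarrow> odd (card C)"
    and "C \<in> P \<Longrightarrow> D \<in> P \<Longrightarrow> C \<noteq> D \<Longrightarrow> C \<inter> D = {}"
    and "C \<in> P \<Longrightarrow> D \<in> P \<Longrightarrow> C \<noteq> D \<Longrightarrow> u \<in> C \<Longrightarrow> v \<in> D \<Longrightarrow> {u, v} \<notin> E"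
    and "C \<in> P \<Longrightarrow> C \<subseteq> V - S"
    and "C \<in> P \<Longrightarrow> D \<in> P \<Longrightarrow> x \<in> C \<Longrightarrow> x \<in> D \<Longrightarrow> C = D"
proof -
  note b = assms[unfolded barrier_def]
  show "S \<subseteq> V" and un: "\<Union>P = V - S" using b by simp_all
  show "C \<in> P \<Longrightarrow> odd (card C)" using b by simp
  show "C \<in> P \<Longrightarrow> D \<in> P \<Longrightarrow> C \<noteq> D \<Longrightarrow> C \<inter> D = {}"
    and "C \<in> P \<Longrightarrow> D \<in> P \<Longrightarrow> C \<noteq> D \<Longrightarrow> u \<in> C \<Longrightarrow> v \<in> D \<Longrightarrow> {u, v} \<notin> E"
    using b by simp_all
  show "C \<in> P \<Longrightarrow> C \<subseteq> V - S" using un by blast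
  show "C \<in> P \<Longrightarrow> D \<in> P \<Longrightarrow> x \<in> C \<Longrightarrow> x \<in> D \<Longrightarrow> C = D" using b by (metis disjoint_iff)
qed

lemma barrier_finite:
  assumes "finite V" "barrier E V S P"
  shows "finite S" "finite P" "C \<in> P \<Longrightarrow> finite C"
proof -
  show "finite S" using assms(1) barrierD(1)[OF assms(2)] by (rule finite_subset[rotated])
  have "finite (\<Union>P)" using assms(1) barrierD(2)[OF assms(2)] by simp
  then show "finite P" by (rule finite_UnionD)
  show "finite C" if "C \<in> P"
    using assms(1) barrierD(6)[OF assms(2) that] by (meson finite_Diff finite_subset)
qed

text \<open>All parts are odd, so their total size has the parity of \<open>card P\<close>. If
  \<open>card V\<close> is even, having more parts than elements of \<open>S\<close> therefore means
  at least two more.\<close>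

lemma barrier_parity:
  assumes "finite V" "barrier E V S P"
  shows "even (card V) \<longleftrightarrow> even (card S + card P)"
proof -
  note fin = barrier_finite[OF assms]
  have "card V = card S + card (\<Union>P)"
    using assms(1) fin(1) barrierD(1,2)[OF assms(2)]
    by (metis Diff_disjoint Diff_partition card_Un_disjoint finite_Diff)
  also have "card (\<Union>P) = (\<Sum>C\<in>P. card C)"
    using barrierD(4)[OF assms(2)] fin
    by (intro card_Union_disjoint) (auto simp: pairwise_def disjnt_def)
  finally have "card V = card S + (\<Sum>C\<in>P. card C)" .
  moreover have "even (\<Sum>C\<in>Q. card C) \<longleftrightarrow> even (card Q)" if "finite Q" "Q \<subseteq> P" for Q
    using that
    by (induction Q rule: finite_induct) (use barrierD(3)[OF assms(2)] in auto)
  ultimately show ?thesis using fin by auto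
qed

text \<open>Each \<open>s\<close> is paired with a neighbour in \<open>g s\<close>, and criticality
  matches the rest of that part; injectivity of \<open>g\<close> keeps these pieces
  disjoint.\<close>

lemma tileable_matched_parts:
  assumes "barrier E V S P" "\<forall>C\<in>P. critical E C" "inj_on g S"
    and g: "\<And>s. s \<in> S \<Longrightarrow> g s \<in> P \<and> touches E s (g s)"
  shows "tileable E {2} (S \<union> \<Union>(g ` S))"
proof -
  note b = barrierD[OF assms(1)]
  have out: "s \<notin> g t" if "s \<in> S" "t \<in> S" for s t
    using b(6)[of "g t"] g[OF that(2)] that(1) by auto
  have "tileable E {2} (\<Union>s\<in>S. insert s (g s))"
  proof (rule tileable_UN)
    fix s assume s: "s \<in> S"
    obtain c where c: "c \<in> g s" "{s, c} \<in> E" using g[OF s] by (auto simp: touches_def)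
    have sg: "s \<notin> g s" using out s by blast
    have "tileable E {2} (set [s, c])" using c sg by (intro tileable_path) auto
    moreover have "tileable E {2} (g s - {c})"
      using assms(2) g[OF s] c by (auto simp: critical_def)
    ultimately have "tileable E {2} (set [s, c] \<union> (g s - {c}))"
      using sg by (intro tileable_Un) auto
    moreover have "set [s, c] \<union> (g s - {c}) = insert s (g s)" using c by auto
    ultimately show "tileable E {2} (insert s (g s))" by simp
  next
    fix s t assume st: "s \<in> S" "t \<in> S" "s \<noteq> t"
    have "g s \<noteq> g t" using st assms(3) by (auto dest: inj_onD)
    then have "g s \<inter> g t = {}" using b(4) g st by blast
    moreover have "s \<notin> g t" "t \<notin> g s" using out st by blast+
    ultimately show "insert s (g s) \<inter> insert t (g t) = {}" using st by auto
  qed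
  moreover have "(\<Union>s\<in>S. insert s (g s)) = S \<union> \<Union>(g ` S)" by auto
  ultimately show ?thesis by simp
qed

lemma finite_has_greatest:
  fixes f :: "'b \<Rightarrow> int"
  assumes "finite A" "A \<noteq> {}"
  shows "\<exists>x\<in>A. \<forall>y\<in>A. f y \<le> f x"
proof -
  have "Max (f ` A) \<in> f ` A" using assms by simp
  then obtain x where "x \<in> A" "Max (f ` A) = f x" by blast
  then show ?thesis using assms by (metis Max_ge finite_imageI imageI)
qed

text \<open>The barrier is chosen with \<open>\<bar>P\<bar> - \<bar>S\<bar>\<close> maximal and then with \<open>\<bar>S\<bar>\<close> maximal. If \<open>C - {c}\<close> had no
  perfect matching, its own decomposition (by induction) would have at least two parts in excess
  by parity, and splitting \<open>C\<close> accordingly would enlarge \<open>S\<close>.\<close>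

lemma gallai_edmonds:
  assumes "finite V"
  shows "\<exists>S P g. barrier E V S P \<and> (\<forall>C\<in>P. critical E C) \<and>
           inj_on g S \<and> (\<forall>s\<in>S. g s \<in> P \<and> touches E s (g s))"
  using assms
proof (induction "card V" arbitrary: V rule: less_induct)
  case less
  note finV = less.prems
  \<comment> \<open>The excess of parts over separating vertices; it is an integer because it can be
    negative, as at \<open>(V, {})\<close>.\<close>
  define val where "val = (\<lambda>(S :: 'a set, P :: 'a set set). int (card P) - int (card S))"
  define BB where "BB = {(S, P). barrier E V S P}"
  have "BB \<subseteq> Pow V \<times> Pow (Pow V)" unfolding BB_def using barrierD(1,6) by fast
  then have finBB: "finite BB" using finV by (meson finite_Pow_iff finite_SigmaI finite_subset)
  have "(V, {}) \<in> BB" unfolding BB_def barrier_def by auto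
  then obtain q where q: "q \<in> BB" "\<And>y. y \<in> BB \<Longrightarrow> val y \<le> val q"
    using finite_has_greatest[OF finBB, of val] by blast
  let ?Q = "{y \<in> BB. val y = val q}"
  have "finite ?Q" "?Q \<noteq> {}" using finBB q(1) by (simp, blast)
  then obtain x where x: "x \<in> BB" "val x = val q"
    "\<And>y. y \<in> BB \<Longrightarrow> val y = val q \<Longrightarrow> int (card (fst y)) \<le> int (card (fst x))"
    using finite_has_greatest[of ?Q "\<lambda>y. int (card (fst y))"] by blast
  obtain S P where SPx: "x = (S, P)" by (cases x)
  have SP: "barrier E V S P" "val (S, P) = val q" using x(1,2) SPx by (simp_all add: BB_def)
  have larger: "card S' \<le> card S" if "barrier E V S' P'" "val (S', P') = val q" for S' P'
    using x(3)[of "(S', P')"] that SPx by (simp add: BB_def)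
  have opt: "int (card P') - int (card S') \<le> int (card P) - int (card S)"
    if "barrier E V S' P'" for S' P'
    using q(2)[of "(S', P')"] SP(2) that unfolding BB_def val_def by auto
  have opt_larger: "card S' \<le> card S"
    if "barrier E V S' P'" "int (card P) - int (card S) \<le> int (card P') - int (card S')" for S' P'
    using larger[OF that(1)] opt[OF that(1)] that(2) SP(2) unfolding val_def by auto
  note fin = barrier_finite[OF finV SP(1)]
  note b = barrierD[OF SP(1)]

  \<comment> \<open>Criticality of the parts\<close>
  have crit: "critical E C" if C: "C \<in> P" for C
    unfolding critical_def
  proof
    fix c assume c: "c \<in> C"
    let ?W = "C - {c}"
    have CV: "C \<subseteq> V" "C \<inter> S = {}" using b(6)[OF C] by blast+
    have finC: "finite C" using fin(3) C by blast
    have "card ?W < card V"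
      using c CV finV by (intro psubset_card_mono) auto
    then obtain S' P' g where W: "barrier E ?W S' P'" "\<forall>C\<in>P'. critical E C" "inj_on g S'"
      "\<And>s. s \<in> S' \<Longrightarrow> g s \<in> P' \<and> touches E s (g s)"
      using less.hyps[of ?W] finC by auto
    note finW = barrier_finite[OF finite_Diff[OF finC] W(1)]
    note bW = barrierD[OF W(1)]
    have "even (card ?W)" using b(3)[OF C] c finC by auto
    then have par: "even (card S' + card P')" using barrier_parity[OF _ W(1)] finC by auto
    have gP: "g ` S' \<subseteq> P'" using W(4) by blast
    show "tileable E {2} ?W"
    proof (cases "card P' \<le> card S'")
      case True
      \<comment> \<open>An injection into a set that is no larger is onto, so \<open>S'\<close> and
        the matched parts exhaust \<open>C - {c}\<close>.\<close>
      then have "g ` S' = P'"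
        using gP finW(2) W(3) True by (intro card_seteq) (auto simp: card_image)
      then have "S' \<union> \<Union>(g ` S') = ?W" using bW(1,2) by auto
      then show ?thesis using tileable_matched_parts[OF W] by simp
    next
      case False
      then have ge: "card S' + 2 \<le> card P'" using par by presburger
      \<comment> \<open>Replacing \<open>C\<close> by \<open>P'\<close> gains
        \<open>card P' - 1\<close> parts, at least the \<open>card S' + 1\<close> elements that
        \<open>S\<close> gains. The excess does not drop while \<open>S\<close> grows, against the
        choice of \<open>S\<close>.\<close>
      let ?S = "S \<union> insert c S'" and ?P = "(P - {C}) \<union> P'"
      have sub: "D \<subseteq> C" if "D \<in> P'" for D using bW(6)[OF that] by blast
      have ne: "D \<noteq> {}" if "D \<in> P'" for D using bW(3)[OF that] by auto
      have "barrier E V ?S ?P"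
        unfolding barrier_def
      proof (intro conjI)
        show "?S \<subseteq> V" using b(1) bW(1) CV c by blast
        have "\<Union>(P - {C}) = \<Union>P - C" using b(4) C by fast
        then show "\<Union>?P = V - ?S" using b(2) bW(1,2) CV c C by auto
        show "\<forall>D\<in>?P. odd (card D)" using b(3) bW(3) by blast
        have cross: "D \<inter> D' = {} \<and> (\<forall>u\<in>D. \<forall>v\<in>D'. {u, v} \<notin> E \<and> {v, u} \<notin> E)"
          if "D \<in> P - {C}" "D' \<in> P'" for D D'
        proof -
          have "D \<inter> C = {}" "\<forall>u\<in>D. \<forall>v\<in>C. {u, v} \<notin> E"
            using b(4)[of D C] b(5)[of D C] C that by auto
          then show ?thesis using sub[OF that(2)] by (auto simp: insert_commute)
        qed
        show "\<forall>D\<in>?P. \<forall>D'\<in>?P. D \<noteq> D' \<longrightarrow> D \<inter> D' = {} \<and> (\<forall>u\<in>D. \<forall>v\<in>D'. {u, v} \<notin> E)"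
        proof (intro ballI impI)
          fix D D' assume D: "D \<in> ?P" "D' \<in> ?P" "D \<noteq> D'"
          consider "D \<in> P - {C}" "D' \<in> P - {C}" | "D \<in> P'" "D' \<in> P'"
            | "D \<in> P - {C}" "D' \<in> P'" | "D \<in> P'" "D' \<in> P - {C}" using D by blast
          then show "D \<inter> D' = {} \<and> (\<forall>u\<in>D. \<forall>v\<in>D'. {u, v} \<notin> E)"
          proof cases
            case 1 then show ?thesis using b(4)[of D D'] b(5)[of D D'] D(3) by auto
          next
            case 2 then show ?thesis using bW(4)[of D D'] bW(5)[of D D'] D(3) by auto
          next
            case 3 then show ?thesis using cross by blast
          next
            case 4 then show ?thesis using cross by blast
          qed
        qed
      qed
      moreover have cS: "card ?S = card S + card S' + 1"
      proof -
        have "S \<inter> insert c S' = {}" "c \<notin> S'" using CV c bW(1) by blast+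
        then show ?thesis using fin(1) finW(1) by (simp add: card_Un_disjoint)
      qed
      moreover have "card ?P = card P - 1 + card P'"
      proof -
        have "D \<notin> P'" if "D \<in> P - {C}" for D
        proof
          assume "D \<in> P'"
          then have "D \<subseteq> C" "D \<noteq> {}" using sub ne by auto
          moreover have "D \<inter> C = {}" using b(4) C that by blast
          ultimately show False by blast
        qed
        then have "(P - {C}) \<inter> P' = {}" by blast
        then show ?thesis using fin(2) finW(2) C by (simp add: card_Un_disjoint)
      qed
      moreover have "card P > 0" using C fin(2) by (auto simp: card_gt_0_iff)
      ultimately have "card ?S \<le> card S" using ge by (intro opt_larger) auto
      then show ?thesis using cS by simp
    qed
  qed

  \<comment> \<open>Matching the separating set into the parts\<close>
  have "\<exists>g. inj_on g S \<and> (\<forall>s\<in>S. g s \<in> {C \<in> P. touches E s C})"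
  proof (rule hall)
    fix A assume A: "A \<subseteq> S"
    define Q where "Q = \<Union>((\<lambda>s. {C \<in> P. touches E s C}) ` A)"
    have QP: "Q \<subseteq> P" unfolding Q_def by auto
    have finQ: "finite Q" using QP fin(2) finite_subset by blast
    have finA: "finite A" using A fin(1) finite_subset by blast
    have far: "{s, u} \<notin> E" if "s \<in> A" "C \<in> P - Q" "u \<in> C" for s C u
      using that unfolding Q_def touches_def by blast
    \<comment> \<open>moving \<open>B\<close> out of \<open>S\<close> merges \<open>B\<close> with the parts in \<open>Q\<close> to a single part\<close>
    have merge: "card B + 1 \<le> card Q"
      if B: "B \<subseteq> A" "odd (card (B \<union> \<Union>Q))" for B
    proof -
      let ?C = "B \<union> \<Union>Q" and ?S = "S - B" and ?P = "insert (B \<union> \<Union>Q) (P - Q)"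
      have new: "C \<inter> ?C = {} \<and> (\<forall>u\<in>C. \<forall>v\<in>?C. {u, v} \<notin> E \<and> {v, u} \<notin> E)" if C: "C \<in> P" "C \<notin> Q" for C
      proof -
        have "C \<inter> B = {}" using b(6)[OF C(1)] A B by blast
        moreover have "C \<inter> \<Union>Q = {}" using C b(4) QP by fast
        moreover have "{u, v} \<notin> E \<and> {v, u} \<notin> E" if "u \<in> C" "v \<in> B" for u v
          using far[of v C u] that C B by (auto simp: insert_commute)
        moreover have "{u, v} \<notin> E \<and> {v, u} \<notin> E" if uv: "u \<in> C" "v \<in> D" "D \<in> Q" for u v D
        proof -
          have "C \<noteq> D" "C \<in> P" "D \<in> P" using C uv QP by auto
          then show ?thesis using b(5)[of C D u v] b(5)[of D C v u] uv by blast
        qed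
        ultimately show ?thesis by blast
      qed
      have "barrier E V ?S ?P"
        unfolding barrier_def
      proof (intro conjI)
        show "?S \<subseteq> V" using b(1) by blast
        have "\<Union>P = \<Union>(P - Q) \<union> \<Union>Q" using QP by blast
        then have "\<Union>?P = B \<union> \<Union>P" by auto
        then show "\<Union>?P = V - ?S" using b(1,2) A B by auto
        show "\<forall>D\<in>?P. odd (card D)" using b(3) B by blast
        show "\<forall>D\<in>?P. \<forall>D'\<in>?P. D \<noteq> D' \<longrightarrow> D \<inter> D' = {} \<and> (\<forall>u\<in>D. \<forall>v\<in>D'. {u, v} \<notin> E)"
        proof (intro ballI impI)
          fix D D' assume D: "D \<in> ?P" "D' \<in> ?P" "D \<noteq> D'"
          consider "D \<in> P - Q" "D' \<in> P - Q" | "D \<in> P - Q" "D' = ?C" | "D = ?C" "D' \<in> P - Q"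
            using D by blast
          then show "D \<inter> D' = {} \<and> (\<forall>u\<in>D. \<forall>v\<in>D'. {u, v} \<notin> E)"
          proof cases
            case 1 then show ?thesis using b(4)[of D D'] b(5)[of D D'] D(3) by auto
          next
            case 2 then show ?thesis using new by blast
          next
            case 3 then show ?thesis using new by blast
          qed
        qed
      qed
      \<comment> \<open>The new excess is \<open>card P - card Q + 1 - (card S - card B)\<close>;
        that it is at most the old one is the claimed inequality.\<close>
      note o = opt[OF this]
      have "?C \<noteq> {}" using B(2) by (metis card.empty even_zero)
      then have "?C \<notin> P - Q" using new by blast
      then have "card ?P = Suc (card P - card Q)"
        using fin(2) QP by (simp add: card_Diff_subset finQ)
      moreover have "card Q \<le> card P" using QP fin(2) card_mono by blast
      moreover have "card ?S = card S - card B" "card B \<le> card S"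
        using A B fin(1) by (auto simp: card_Diff_subset finite_subset card_mono)
      ultimately show ?thesis using o by linarith
    qed
    have "card A \<le> card Q"
    \<comment> \<open>The merged part must be odd. If all of \<open>A\<close> gives an even set, one
      vertex \<open>a\<close> stays in \<open>S\<close>, and the \<open>+ 1\<close> in
      \<open>merge\<close> makes up for it.\<close>
    proof (cases "odd (card (A \<union> \<Union>Q))")
      case True
      then show ?thesis using merge[of A] by simp
    next
      case even: False
      show ?thesis
      proof (cases "A = {}")
        case False
        then obtain a where a: "a \<in> A" by blast
        have "a \<notin> \<Union>Q" using a A b(2) QP by blast
        then have "(A \<union> \<Union>Q) = insert a ((A - {a}) \<union> \<Union>Q)" "a \<notin> (A - {a}) \<union> \<Union>Q"
          using a by auto
        moreover have "finite ((A - {a}) \<union> \<Union>Q)" using finA finQ QP fin(3) by auto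
        ultimately have "odd (card ((A - {a}) \<union> \<Union>Q))"
          using even by (metis card_insert_disjoint even_Suc)
        then have "card (A - {a}) + 1 \<le> card Q" using merge[of "A - {a}"] by auto
        then show ?thesis using a finA by (simp add: card_Diff_singleton)
      qed simp
    qed
    then show "card A \<le> card (\<Union>((\<lambda>s. {C \<in> P. touches E s C}) ` A))" unfolding Q_def .
  qed (use fin(1,2) in auto)
  then show ?case using SP(1) crit by blast
qed

section \<open>Long alternating paths\<close>

text \<open>The path grows at the head of the list: first by a neighbour \<open>u\<close> off the
  path, then by the partner of \<open>u\<close> in the matching of the remainder.\<close>

lemma alternating_path:
  assumes "finite C" "v \<in> C" "tileable E {2} (C - {v})" "\<And>x. {x} \<notin> E"
    and deg: "\<And>y. y \<in> C \<Longrightarrow> 2 * k - 1 \<le> card {u \<in> C. {y, u} \<in> E}"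
    and "j \<le> k"
  shows "\<exists>xs. distinct xs \<and> set xs \<subseteq> C \<and> successively (\<lambda>u v. {u, v} \<in> E) xs \<and>
           length xs = 2 * j + 1 \<and> tileable E {2} (C - set xs)"
  using \<open>j \<le> k\<close>
proof (induction j)
  case 0
  then show ?case using assms by (intro exI[of _ "[v]"]) auto
next
  case (Suc j)
  then obtain xs where xs: "distinct xs" "set xs \<subseteq> C" "successively (\<lambda>u v. {u, v} \<in> E) xs"
    "length xs = 2 * j + 1" "tileable E {2} (C - set xs)" by auto
  then obtain y ys where y: "xs = y # ys" by (cases xs) auto
  \<comment> \<open>Besides \<open>y\<close> the path has \<open>2 * j \<le> 2 * k - 2\<close>
    vertices, fewer than \<open>y\<close> has neighbours in \<open>C\<close>. That \<open>u\<close>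
    differs from \<open>y\<close> follows from the absence of loops.\<close>
  have "\<exists>u\<in>{u \<in> C. {y, u} \<in> E}. u \<notin> set ys"
  proof (rule ccontr)
    assume "\<not> ?thesis"
    then have "card {u \<in> C. {y, u} \<in> E} \<le> card (set ys)"
      by (intro card_mono) auto
    also have "\<dots> \<le> 2 * j" using xs y card_length[of ys] by simp
    finally show False using deg[of y] xs y Suc.prems by auto
  qed
  then obtain u where u: "u \<in> C" "{y, u} \<in> E" "u \<notin> set ys" by blast
  then have "u \<notin> set xs" using y assms(4)[of y] by auto
  then obtain w where w: "w \<in> C - set xs" "w \<noteq> u" "{u, w} \<in> E"
    "tileable E {2} (C - set xs - {u, w})"
    using tileable_2_partner[OF xs(5), of u] u by auto
  have "C - set xs - {u, w} = C - set (w # u # xs)" by auto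
  then show ?case
    using xs y u w \<open>u \<notin> set xs\<close>
    by (intro exI[of _ "w # u # xs"]) (auto simp: insert_commute)
qed

lemma critical_tileable:
  assumes "finite C" "C \<noteq> {}" "critical E C" "\<And>x. {x} \<notin> E"
    and "\<And>y. y \<in> C \<Longrightarrow> 2 * k - 1 \<le> card {u \<in> C. {y, u} \<in> E}"
  shows "tileable E {2, 2 * k + 1} C"
proof -
  obtain v where "v \<in> C" using assms(2) by blast
  then obtain xs where xs: "distinct xs" "set xs \<subseteq> C" "successively (\<lambda>u v. {u, v} \<in> E) xs"
    "length xs = 2 * k + 1" "tileable E {2} (C - set xs)"
    using alternating_path[of C v E k k] assms unfolding critical_def by auto
  have "tileable E {2, 2 * k + 1} (set xs \<union> (C - set xs))"
    using xs by (intro tileable_Un tileable_path tileable_mono[OF xs(5)]) auto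
  then show ?thesis using xs(2) by (simp add: Un_absorb1)
qed

section \<open>The factor\<close>

text \<open>The constant \<open>2 * k - 1\<close> is also the degree bound of
  \<open>critical_tileable\<close>: what a vertex of a part lacks in neighbours inside the part,
  expansion supplies in \<open>S\<close>.\<close>

lemma tileable_of_expansion:
  assumes finV: "finite V" and loop: "\<And>x. {x} \<notin> E" and "k \<ge> 1"
    and exp: "\<And>I. I \<subseteq> V \<Longrightarrow> (\<And>x y. x \<in> I \<Longrightarrow> y \<in> I \<Longrightarrow> {x, y} \<notin> E) \<Longrightarrow>
      (2 * k - 1) * card I \<le> card {x \<in> V. \<exists>y\<in>I. {y, x} \<in> E}"
  shows "tileable E {2, 2 * k + 1} V"
proof -
  obtain S P g where SP: "barrier E V S P" "\<forall>C\<in>P. critical E C"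
    and g: "inj_on g S" "\<And>s. s \<in> S \<Longrightarrow> g s \<in> P \<and> touches E s (g s)"
    using gallai_edmonds[OF finV] by metis
  note fin = barrier_finite[OF finV SP(1)]
  note b = barrierD[OF SP(1)]
  define T where "T = {C \<in> P. \<exists>y\<in>C. card {u \<in> C. {y, u} \<in> E} < 2 * k - 1}"
  have TP: "T \<subseteq> P" unfolding T_def by auto
  have finT: "finite T" using TP fin(2) by (rule finite_subset)
  have "\<forall>C\<in>T. \<exists>y. y \<in> C \<and> card {u \<in> C. {y, u} \<in> E} < 2 * k - 1"
    unfolding T_def by blast
  then obtain z where z: "\<And>C. C \<in> T \<Longrightarrow> z C \<in> C"
    "\<And>C. C \<in> T \<Longrightarrow> card {u \<in> C. {z C, u} \<in> E} < 2 * k - 1"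
    by metis
  have "\<exists>h. inj_on h T \<and> (\<forall>C\<in>T. h C \<in> {s \<in> S. touches E s C})"
  proof (rule hall)
    fix B assume B: "B \<subseteq> T"
    define N where "N = \<Union>((\<lambda>C. {s \<in> S. touches E s C}) ` B)"
    define X where "X = {x \<in> V. \<exists>y\<in>z ` B. {y, x} \<in> E}"
    have finB: "finite B" using B finT by (rule finite_subset)
    have BP: "C \<in> P" if "C \<in> B" for C using that B TP by blast
    have zB: "z C \<in> C" if "C \<in> B" for C using that B z by blast
    have "inj_on z B"
    proof (rule inj_onI)
      fix C D assume "C \<in> B" "D \<in> B" "z C = z D"
      then show "C = D" using b(7)[OF BP BP] zB by metis
    qed
    moreover have "(2 * k - 1) * card (z ` B) \<le> card X"
      unfolding X_def
    proof (rule exp)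
      show "z ` B \<subseteq> V" using b(6) BP zB by blast
      \<comment> \<open>Representatives of different parts are not adjacent, since no edge joins two
        parts.\<close>
      show "{x, y} \<notin> E" if xy: "x \<in> z ` B" "y \<in> z ` B" for x y
      proof -
        obtain C D where CD: "C \<in> B" "D \<in> B" "x = z C" "y = z D" using xy by blast
        show ?thesis
        proof (cases "C = D")
          case True
          then show ?thesis using CD loop[of x] by simp
        next
          case False
          then show ?thesis using b(5)[OF BP BP] CD zB by blast
        qed
      qed
    qed
    ultimately have 1: "(2 * k - 1) * card B \<le> card X" by (simp add: card_image)
    \<comment> \<open>A neighbour of \<open>z C\<close> either lies in \<open>S\<close>, and then
      touches \<open>C\<close>, or lies in \<open>C\<close> itself.\<close>
    have "X \<subseteq> (\<Union>C\<in>B. {u \<in> C. {z C, u} \<in> E}) \<union> N"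
    proof
      fix x assume "x \<in> X"
      then obtain C where C: "x \<in> V" "C \<in> B" "{z C, x} \<in> E" unfolding X_def by blast
      show "x \<in> (\<Union>C\<in>B. {u \<in> C. {z C, u} \<in> E}) \<union> N"
      proof (cases "x \<in> S")
        case True
        then have "touches E x C" using C zB by (auto simp: touches_def insert_commute)
        then show ?thesis using True C unfolding N_def by blast
      next
        case False
        then obtain D where D: "D \<in> P" "x \<in> D" using b(2) C by blast
        then have "D = C" using b(5)[OF BP D(1)] C D zB by blast
        then show ?thesis using C D by blast
      qed
    qed
    moreover have "finite (\<Union>C\<in>B. {u \<in> C. {z C, u} \<in> E})" "finite N"
      using finB fin(1,3) BP unfolding N_def by auto
    ultimately have cX: "card X \<le> card (\<Union>C\<in>B. {u \<in> C. {z C, u} \<in> E}) + card N"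
      by (meson card_Un_le card_mono finite_UnI le_trans)
    \<comment> \<open>The parts in \<open>B\<close> hold at most \<open>(2 * k - 2) * card B\<close>
      of the at least \<open>(2 * k - 1) * card B\<close> elements of \<open>X\<close>, so
      \<open>N\<close> has at least \<open>card B\<close> elements.\<close>
    have "card {u \<in> C. {z C, u} \<in> E} \<le> 2 * k - 2" if "C \<in> B" for C
      using z(2)[of C] that B by auto
    then have "(\<Sum>C\<in>B. card {u \<in> C. {z C, u} \<in> E}) \<le> card B * (2 * k - 2)"
      using sum_bounded_above[of B "\<lambda>C. card {u \<in> C. {z C, u} \<in> E}" "2 * k - 2"] by simp
    moreover have "card (\<Union>C\<in>B. {u \<in> C. {z C, u} \<in> E}) \<le> (\<Sum>C\<in>B. card {u \<in> C. {z C, u} \<in> E})"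
      using finB by (rule card_UN_le)
    ultimately have "(2 * k - 1) * card B \<le> card B * (2 * k - 2) + card N"
      using 1 cX by linarith
    moreover have "2 * k - 1 = Suc (2 * k - 2)" using \<open>k \<ge> 1\<close> by simp
    ultimately show "card B \<le> card (\<Union>((\<lambda>C. {s \<in> S. touches E s C}) ` B))"
      unfolding N_def[symmetric] by (simp add: mult.commute)
  qed (use finT fin(1) in auto)
  then obtain h where h: "inj_on h T" "\<And>C. C \<in> T \<Longrightarrow> h C \<in> S \<and> touches E (h C) C"
    by blast
  \<comment> \<open>\<open>f\<close> saturates \<open>S\<close>, as \<open>g\<close> does, and
    covers all of \<open>T\<close>, as \<open>h\<close> does; a part it misses satisfies the degree
    bound.\<close>
  obtain f where f: "inj_on f S" "\<And>s. s \<in> S \<Longrightarrow> touches E s (f s) \<and> f s \<in> g ` S \<union> T" "T \<subseteq> f ` S"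
    using mendelsohn_dulmage[of g S "touches E" h T] g h by metis
  have fP: "f s \<in> P" if "s \<in> S" for s using f(2)[OF that] g(2) TP by auto
  have "tileable E {2} (S \<union> \<Union>(f ` S))"
    using tileable_matched_parts[OF SP f(1)] f(2) fP by blast
  then have "tileable E {2, 2 * k + 1} (S \<union> \<Union>(f ` S))" by (rule tileable_mono) auto
  moreover have "tileable E {2, 2 * k + 1} (\<Union>C\<in>P - f ` S. C)"
  proof (rule tileable_UN)
    fix C assume C: "C \<in> P - f ` S"
    then have CP: "C \<in> P" and "C \<notin> T" using f(3) by auto
    then have deg: "2 * k - 1 \<le> card {u \<in> C. {y, u} \<in> E}" if "y \<in> C" for y
      using that not_less unfolding T_def by blast
    have "C \<noteq> {}" using b(3)[OF CP] by auto
    then show "tileable E {2, 2 * k + 1} C"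
      using fin(3)[OF CP] SP(2) CP loop deg by (intro critical_tileable) auto
  next
    fix C D assume "C \<in> P - f ` S" "D \<in> P - f ` S" "C \<noteq> D"
    then show "C \<inter> D = {}" using b(4) by blast
  qed
  moreover have "(S \<union> \<Union>(f ` S)) \<inter> (\<Union>C\<in>P - f ` S. C) = {}"
  proof -
    have "S \<inter> C = {}" if "C \<in> P" for C using b(6)[OF that] by blast
    moreover have "f s \<inter> C = {}" if "s \<in> S" "C \<in> P - f ` S" for s C
    proof -
      have "f s \<noteq> C" using that by blast
      then show ?thesis using b(4) fP that by blast
    qed
    ultimately show ?thesis by blast
  qed
  ultimately have "tileable E {2, 2 * k + 1} ((S \<union> \<Union>(f ` S)) \<union> (\<Union>C\<in>P - f ` S. C))"
    by (rule tileable_Un)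
  moreover have "(S \<union> \<Union>(f ` S)) \<union> (\<Union>C\<in>P - f ` S. C) = V"
  proof -
    have "\<Union>P = \<Union>(f ` S) \<union> (\<Union>C\<in>P - f ` S. C)" using fP by auto
    moreover have "V = S \<union> \<Union>P" using b(1,2) by blast
    ultimately show ?thesis by (simp only: Un_assoc)
  qed
  ultimately show ?thesis by simp
qed

section \<open>From component counts to the expansion of independent sets\<close>

lemma card_le_isolated:
  assumes "finite V" "I \<subseteq> V" "\<And>x y. x \<in> I \<Longrightarrow> y \<in> I \<Longrightarrow> {x, y} \<notin> E"
  shows "card I \<le> comp_count 1 E (V - {x \<in> V. \<exists>y\<in>I. {y, x} \<in> E})"
proof -
  define U where "U = V - {x \<in> V. \<exists>y\<in>I. {y, x} \<in> E}"
  have IU: "I \<subseteq> U" unfolding U_def using assms by blast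
  have comp: "component_of E U y = {y}" if y: "y \<in> I" for y
  proof -
    \<comment> \<open>The first step of a walk from \<open>y\<close> would lead to a neighbour of
      \<open>y\<close>, and all of these are deleted.\<close>
    have "u = y" if "(adj_in E U)\<^sup>*\<^sup>* y u" for u
      using that
    proof (cases rule: converse_rtranclpE)
      case (step w)
      then show ?thesis using y unfolding adj_in_def U_def by blast
    qed simp
    then show ?thesis unfolding component_of_def using IU y by auto
  qed
  have "card I = card ((\<lambda>y. {y}) ` I)" by (simp add: card_image)
  also have "\<dots> \<le> card {C \<in> components E U. card C = 1}"
  proof (rule card_mono)
    show "finite {C \<in> components E U. card C = 1}"
      using assms(1) unfolding components_def U_def by auto
    show "(\<lambda>y. {y}) ` I \<subseteq> {C \<in> components E U. card C = 1}"
    proof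
      fix C assume "C \<in> (\<lambda>y. {y}) ` I"
      then obtain y where "y \<in> I" "C = {y}" by blast
      then show "C \<in> {C \<in> components E U. card C = 1}"
        using comp IU unfolding components_def by force
    qed
  qed
  finally show ?thesis unfolding comp_count_def U_def .
qed

theorem theorem1:
  fixes V :: "'a set" and E :: "'a set set" and k :: nat
  assumes "k \<ge> 3"
    and "simple_graph V E"
    and "\<forall>X\<subseteq>V. real (\<Sum>j<k. comp_count (2*j+1) E (V - X))
                     \<le> 5 / (6 * real k ^ 2) * real (card X)"
  shows "\<exists>F. path_factor {2, 2*k+1} V E F"
proof (rule tileable_path_factor, rule tileable_of_expansion)
  show finV: "finite V" using assms(2) by (simp add: simple_graph_def)
  show "{x} \<notin> E" for x
    using assms(2) unfolding simple_graph_def by (metis doubleton_eq_iff insert_absorb2)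
  show "k \<ge> 1" using assms(1) by simp
  fix I assume I: "I \<subseteq> V" "\<And>x y. x \<in> I \<Longrightarrow> y \<in> I \<Longrightarrow> {x, y} \<notin> E"
  define X where "X = {x \<in> V. \<exists>y\<in>I. {y, x} \<in> E}"
  \<comment> \<open>Isolated vertices are the components counted by the summand
    \<open>j = 0\<close>.\<close>
  have "card I \<le> comp_count (2*0+1) E (V - X)"
    using card_le_isolated[OF finV I] by (simp add: X_def)
  also have "\<dots> \<le> (\<Sum>j<k. comp_count (2*j+1) E (V - X))"
    using assms(1) by (intro member_le_sum[where f = "\<lambda>j. comp_count (2*j+1) E (V - X)"]) auto
  finally have "real (card I) \<le> real (\<Sum>j<k. comp_count (2*j+1) E (V - X))"
    using of_nat_le_iff by blast
  also have "\<dots> \<le> 5 / (6 * real k ^ 2) * real (card X)"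
    using assms(3) by (auto simp: X_def)
  finally have "6 * real k ^ 2 * real (card I) \<le> 5 * real (card X)"
    using assms(1) by (simp add: field_simps)
  then have "real (6 * k ^ 2 * card I) \<le> real (5 * card X)" by simp
  then have "6 * k ^ 2 * card I \<le> 5 * card X" using of_nat_le_iff by blast
  \<comment> \<open>The hypothesis yields expansion by \<open>6 * k ^ 2 / 5\<close>, which is at
    least \<open>2 * k - 1\<close> because \<open>10 \<le> 6 * k\<close>.\<close>
  moreover have "5 * (2 * k - 1) \<le> 6 * k ^ 2"
  proof -
    have "5 * (2 * k - 1) \<le> 10 * k" by simp
    also have "\<dots> \<le> (6 * k) * k" using assms(1) by (intro mult_right_mono) auto
    finally show ?thesis by (simp add: power2_eq_square mult.assoc)
  qed
  then have "5 * (2 * k - 1) * card I \<le> 6 * k ^ 2 * card I" by (rule mult_right_mono) simp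
  ultimately show "(2 * k - 1) * card I \<le> card {x \<in> V. \<exists>y\<in>I. {y, x} \<in> E}"
    unfolding X_def by linarith
qed

end
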